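(* Let $\zeta=\{\zeta_n\}_{n\ge0}$ be a stationary stretched-exponentially $\alpha$-mixing sequence with values in a metric space $(\mathcal Y,d_0)$, and let $(\Omega,\mathcal F,P,\theta)$ be the associated two sided shift, $\Omega=\mathcal Y^{\mathbb Z}$, as in the context. Let $n_0\in\mathbb N$, $a=(a_0,\dots,a_{n_0-1})\in\mathcal Y^{n_0}$ and let $\omega_0=(\dots,a,a,a,\dots)\in\Omega$ be the corresponding periodic point, so that $\theta^{n_0}\omega_0=\omega_0$. Suppose that for every integer $s\ge1$, $$P_0\big(\zeta_{i+(j-1)n_0}\in A_{i,j};\ i=0,1,\dots,n_0-1,\ 1\le j\le s\big)>0$$ for any open sets $A_{i,j}\subset\mathcal Y$ so that $a_i\in A_{i,j}$ for all $i$ and $j$. Fix any $\beta>0$. Then for any integer $s>0$ and neighborhoods $B_{\theta^i\omega_0}$ of $\theta^i\omega_0$, $i=0,1,\dots,n_0-1$, the set $B_{\omega_0,n_0,s}=\bigcap_{i=0}^{sn_0-1}\theta^{-i}B_{\theta^i\omega_0}$ satisfies that for any $n\ge1$, $$P\Big\{\omega:\ \sum_{j=0}^{n-1}\mathbb I_{B_{\omega_0,n_0,s}}(\theta^j\omega)\le cn\Big\}\le\frac{d}{n^\beta},$$ where $c$ and $d$ are positive constants which depend only on $s$, $\omega_0$ and $n_0$.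
   Context: $\zeta=\{\zeta_n,\ n\ge0\}$ is a stationary sequence of random variables on a probability space $(\Omega_0,\mathcal F_0,P_0)$ taking values in a metric space $(\mathcal Y,d_0)$ with $\mathrm{diam}\,\mathcal Y\le1$. $\Omega=\mathcal Y^{\mathbb Z}$, $\mathcal F$ is the product $\sigma$-algebra, $P$ is given by $P\{(y_j)_{j\in\mathbb Z}:y_i\in A_i,\ |i|\le N\}=P_0(\zeta_i\in A_{i-N};\ 0\le i\le2N)$, and $\theta$ is the two sided shift $(\theta y)_i=y_{i+1}$. $\Omega$ carries the metric $d_\Omega(\{a_n\},\{b_n\})=\sum_{n\in\mathbb Z}2^{-|n|}d_0(a_n,b_n)$. Stretched-exponential $\alpha$-mixing means: there are constants $\mathsf a,\mathsf b,\mathsf c>0$ such that for any $n,k\ge1$, $A\in\sigma\{\zeta_1,\dots,\zeta_k\}$ and $B\in\sigma\{\zeta_i:i\ge k+n\}$, $|P_0(A\cap B)-P_0(A)P_0(B)|\le\mathsf a\,e^{-\mathsf b n^{\mathsf c}}$. $\omega_0=(\dots,a,a,a,\dots)$ is the sequence with $(\omega_0)_{i+kn_0}=a_i$ for $0\le i<n_0$, $k\in\mathbb Z$ (so for $i\ge n_0$, $B_{\theta^i\omega_0}$ is $B_{\theta^{i\bmod n_0}\omega_0}$). $\mathbb I_A$ is the indicator of $A$.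
   Formalization: The constants c and d may also depend on the chosen neighborhoods (and the process; d also on β); constants uniform over all neighborhoods cannot exist, since the visit frequency tends to the set's probability, which can be arbitrarily small (e.g. i.i.d. uniform variables). *)

theory Defs
  imports "HOL-Probability.Probability"
begin

definition stationary :: "'w measure \<Rightarrow> (nat \<Rightarrow> 'w \<Rightarrow> 'y::topological_space) \<Rightarrow> bool" where
  "stationary M \<zeta> \<longleftrightarrow>
     (\<forall>k. distr M (\<Pi>\<^sub>M n\<in>UNIV. borel) (\<lambda>w n. \<zeta> (n + k) w) =
          distr M (\<Pi>\<^sub>M n\<in>UNIV. borel) (\<lambda>w n. \<zeta> n w))"

definition sigma_gen_by ::
    "'w measure \<Rightarrow> (nat \<Rightarrow> 'w \<Rightarrow> 'y::topological_space) \<Rightarrow> nat set \<Rightarrow> 'w set set" where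
  "sigma_gen_by M \<zeta> I =
     sigma_sets (space M) (\<Union>i\<in>I. {\<zeta> i -` A \<inter> space M | A. A \<in> sets borel})"

definition stretched_exp_alpha_mixing ::
    "'w measure \<Rightarrow> (nat \<Rightarrow> 'w \<Rightarrow> 'y::topological_space) \<Rightarrow> bool" where
  "stretched_exp_alpha_mixing M \<zeta> \<longleftrightarrow>
     (\<exists>a b c :: real. a > 0 \<and> b > 0 \<and> c > 0 \<and>
        (\<forall>n\<ge>1. \<forall>k\<ge>1. \<forall>A \<in> sigma_gen_by M \<zeta> {1..k}. \<forall>B \<in> sigma_gen_by M \<zeta> {k + n..}.
           \<bar>measure M (A \<inter> B) - measure M A * measure M B\<bar> \<le> a * exp (- b * real n powr c)))"

text \<open>For an arbitrary metric space the Kolmogorov extension theorem need not apply, so the law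
  \<open>P\<close> of the two sided shift is characterised rather than constructed; it is unique when it
  exists, since cylinders of the given form generate the product sigma algebra.\<close>

definition two_sided_shift_law ::
    "'w measure \<Rightarrow> (nat \<Rightarrow> 'w \<Rightarrow> 'y::topological_space) \<Rightarrow> (int \<Rightarrow> 'y) measure \<Rightarrow> bool" where
  "two_sided_shift_law M \<zeta> P \<longleftrightarrow>
     prob_space P \<and> sets P = sets (\<Pi>\<^sub>M i\<in>UNIV. borel) \<and>
     (\<forall>(N::nat) A. (\<forall>i. A i \<in> sets borel) \<longrightarrow>
        measure P {y. \<forall>i\<in>{- int N..int N}. y i \<in> A i} =
        measure M {w \<in> space M. \<forall>i\<in>{0..2 * N}. \<zeta> i w \<in> A (int i - int N)})"

definition lshift :: "(int \<Rightarrow> 'y) \<Rightarrow> int \<Rightarrow> 'y" where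
  "lshift y = (\<lambda>i. y (i + 1))"

text \<open>The series converges when all distances in \<open>'y\<close> are bounded by 1; otherwise
  \<open>infsum\<close> may return the default value 0.\<close>

definition dist_seq :: "(int \<Rightarrow> 'y::metric_space) \<Rightarrow> (int \<Rightarrow> 'y) \<Rightarrow> real" where
  "dist_seq x y = (\<Sum>\<^sub>\<infinity>n\<in>UNIV. dist (x n) (y n) / 2 ^ nat \<bar>n\<bar>)"

definition seq_neighborhood :: "(int \<Rightarrow> 'y::metric_space) \<Rightarrow> (int \<Rightarrow> 'y) set \<Rightarrow> bool" where
  "seq_neighborhood x U \<longleftrightarrow> (\<exists>\<epsilon>>0. {y. dist_seq x y < \<epsilon>} \<subseteq> U)"

text \<open>\<open>B i\<close>, for \<open>i < n0\<close>, is the neighborhood of the \<open>i\<close>-th point of the orbit.\<close>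

definition orbit_set :: "(nat \<Rightarrow> (int \<Rightarrow> 'y) set) \<Rightarrow> nat \<Rightarrow> nat \<Rightarrow> (int \<Rightarrow> 'y) set" where
  "orbit_set B n0 s = (\<Inter>i<s * n0. (lshift ^^ i) -` B (i mod n0))"

end

theory Submission
  imports Defs "HOL-Library.Discrete_Functions" "HOL-Real_Asymp.Real_Asymp"
begin

text \<open>
  Every neighborhood of a point in the product space contains a cylinder, so the orbit set contains
  a window condition \<open>y m \<in> ball (\<omega>0 m) \<delta>\<close> for \<open>\<bar>m\<bar> \<le> L\<close>
  (\<open>orbit_set_contains_cylinder\<close>), and it suffices to count the visits to this cylinder. Its
  probability \<open>p\<close> is positive by the hypothesis on the periodic word, and the number of visits before
  time \<open>n\<close> depends on finitely many coordinates only, so the question can be moved to the one sided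
  process on the original probability space (\<open>two_sided_shift_law_window\<close>).

  There, split the times below \<open>n\<close> into the residue classes modulo \<open>g\<close>, the integer part of
  \<open>sqrt n\<close>. Visits along one class are separated by gaps of length about \<open>g\<close>, hence nearly
  independent: the probability of at most \<open>m\<close> visits among \<open>r\<close> such times is at most
  \<open>2 ^ m * (1 - p / 2) ^ r\<close>, the bound valid for independent events, plus \<open>r\<close> times the mixing
  coefficient (\<open>prob_few_occurrences_le\<close>). For \<open>m \<le> \<kappa> * r\<close> with a small \<open>\<kappa>\<close> depending on
  \<open>p\<close> only, the main term decays exponentially in \<open>r\<close>.
  If there are at most \<open>\<kappa> * n / 2\<close> visits in total, then some class has at most \<open>\<kappa> * r\<close> visits,
  and a union bound over the \<open>g\<close> classes leaves a quantity that is stretched exponentially small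
  in \<open>n\<close>, thus smaller than every power of \<open>n\<close> (\<open>prob_few_visits_polynomial_decay\<close>).
\<close>

section \<open>Few occurrences among weakly dependent events\<close>

lemma card_filter_Suc:
  "card {t. t < Suc r \<and> Q t} = card {t. t < r \<and> Q t} + (if Q r then 1 else 0)"
proof -
  have "{t. t < Suc r \<and> Q t} = (if Q r then insert r {t. t < r \<and> Q t} else {t. t < r \<and> Q t})"
    by (auto simp: less_Suc_eq)
  then show ?thesis by simp
qed

lemma sets_Collect_card_occurrences:
  fixes E :: "nat \<Rightarrow> 'a set"
  assumes E: "\<And>t. t < r \<Longrightarrow> E t \<in> sets N"
  shows "{w \<in> space N. Q (card {t. t < r \<and> w \<in> E t})} \<in> sets N"
proof -
  have "(\<lambda>w. card {t. t < r \<and> w \<in> E t}) \<in> measurable N (count_space UNIV)"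
  proof (rule measurable_card)
    fix t
    have "{w \<in> space N. t \<in> {t. t < r \<and> w \<in> E t}} = (if t < r then E t else {})"
      using sets.sets_into_space[OF E] by auto
    then show "{w \<in> space N. t \<in> {t. t < r \<and> w \<in> E t}} \<in> sets N" using E by simp
  qed
  then have "(\<lambda>w. card {t. t < r \<and> w \<in> E t}) -` {k. Q k} \<inter> space N \<in> sets N"
    by (rule measurable_sets) simp
  also have "(\<lambda>w. card {t. t < r \<and> w \<in> E t}) -` {k. Q k} \<inter> space N =
      {w \<in> space N. Q (card {t. t < r \<and> w \<in> E t})}" by auto
  finally show ?thesis .
qed

text \<open>
  A substitute for the Chernoff bound that needs the covariance estimate for events only, not for
  functions. The event of at most \<open>m\<close> occurrences up to time \<open>r\<close> loses, in the next step, the part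
  where there were exactly \<open>m\<close> and a further one happens; this part has probability at least
  \<open>p\<close> times that of exactly \<open>m\<close>, up to \<open>\<alpha>\<close>. Writing \<open>F m\<close> for the probability of at most
  \<open>m\<close> occurrences, the new value is therefore at most
  \<open>(1 - p) * F m + p * F (m - 1) + \<alpha>\<close>, and the right hand side of the claim is preserved by this
  recursion since \<open>1 - p + p / 2 = 1 - p / 2\<close>.
\<close>

lemma (in prob_space) prob_few_occurrences_le:
  fixes E :: "nat \<Rightarrow> 'a set" and p \<alpha> :: real
  assumes E: "\<And>t. E t \<in> events"
    and p: "0 \<le> p" "p \<le> 1"
    and mix: "\<And>t A. A \<in> sigma_sets (space M) (E ` {..<t}) \<Longrightarrow> p * prob A - \<alpha> \<le> prob (A \<inter> E t)"
  shows "prob {w \<in> space M. card {t. t < r \<and> w \<in> E t} \<le> m} \<le> 2 ^ m * (1 - p / 2) ^ r + real r * \<alpha>"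
proof (induction r arbitrary: m)
  case 0
  have "prob A \<le> 2 ^ m" for A using prob_le_1[of A] one_le_power[of "2::real" m] by linarith
  then show ?case by simp
next
  case (Suc r)
  define C where "C k = {w \<in> space M. card {t. t < r \<and> w \<in> E t} \<le> k}" for k
  define D where "D = {w \<in> space M. card {t. t < r \<and> w \<in> E t} = m}"
  define q where "q = 1 - p / 2"
  have q: "q \<ge> 0" using p by (simp add: q_def)
  have C: "C k \<in> events" for k unfolding C_def using E by (rule sets_Collect_card_occurrences)
  define N where "N = sigma (space M) (E ` {..<r})"
  have "E ` {..<r} \<subseteq> Pow (space M)" using E sets.sets_into_space by blast
  then have N: "sets N = sigma_sets (space M) (E ` {..<r})" "space N = space M"
    by (simp_all add: N_def)
  have EN: "E t \<in> sets N" if "t < r" for t using that unfolding N by (auto intro: sigma_sets.Basic)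
  have "{w \<in> space N. card {t. t < r \<and> w \<in> E t} = m} \<in> sets N"
    using EN by (rule sets_Collect_card_occurrences)
  then have Dsig: "D \<in> sigma_sets (space M) (E ` {..<r})" by (simp add: D_def N)
  have D: "D \<in> events" unfolding D_def using E by (rule sets_Collect_card_occurrences)
  have split: "{w \<in> space M. card {t. t < Suc r \<and> w \<in> E t} \<le> m} = C m - D \<inter> E r"
    unfolding C_def D_def card_filter_Suc by auto
  have "prob (C m - D \<inter> E r) = prob (C m) - prob (D \<inter> E r)"
    using C D E by (intro finite_measure_Diff) (auto simp: C_def D_def)
  also have "\<dots> \<le> prob (C m) - p * prob D + \<alpha>" using mix[OF Dsig] by simp
  also have "\<dots> \<le> (2 ^ m * q ^ r + real r * \<alpha>) * (1-p) + p * (2 ^ m * q ^ r / 2 + real r * \<alpha>) + \<alpha>"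
  proof (cases m)
    case 0
    then have "D = C m" by (auto simp: C_def D_def)
    have "prob (C m) * (1 - p) \<le> (2 ^ m * q ^ r + real r * \<alpha>) * (1-p)"
      using Suc[of m] p by (intro mult_right_mono) (auto simp: C_def q_def)
    \<comment> \<open>Here \<open>F (m - 1)\<close> is the probability of the empty event, so its bound only has to be nonnegative.\<close>
    moreover have "0 \<le> p * (2 ^ m * q ^ r / 2 + real r * \<alpha>)"
    proof -
      have "- \<alpha> \<le> 0" using mix[of "{}" 0] by (simp add: sigma_sets.Empty)
      then show ?thesis using p q by simp
    qed
    ultimately show ?thesis using \<open>D = C m\<close> by (simp add: algebra_simps)
  next
    case (Suc m')
    have "C m = C m' \<union> D" "C m' \<inter> D = {}" by (auto simp: C_def D_def Suc)
    then have "prob (C m) = prob (C m') + prob D" using C D by (simp add: finite_measure_Union)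
    then have "prob (C m) - p * prob D = prob (C m) * (1 - p) + p * prob (C m')"
      by (simp add: algebra_simps)
    moreover have "prob (C m) * (1 - p) \<le> (2 ^ m * q ^ r + real r * \<alpha>) * (1-p)"
      using Suc.IH[of m] p by (intro mult_right_mono) (auto simp: C_def q_def)
    moreover have "p * prob (C m') \<le> p * (2 ^ m * q ^ r / 2 + real r * \<alpha>)"
      using Suc.IH[of m'] p by (intro mult_left_mono) (auto simp: C_def q_def Suc)
    ultimately show ?thesis by linarith
  qed
  also have "\<dots> = 2 ^ m * q ^ Suc r + real (Suc r) * \<alpha>"
    by (simp add: q_def algebra_simps)
  finally show ?case unfolding split q_def .
qed

text \<open>
  Pigeonhole: the first \<open>r\<close> members of the \<open>g\<close> classes form disjoint sets of times below \<open>n\<close>, so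
  some class has at most the average number of hits.
\<close>

lemma exists_sparse_residue_class:
  fixes g r n :: nat
  assumes "g \<ge> 1" "g * r \<le> n"
  shows "\<exists>u<g. g * card {t. t < r \<and> Q (u + g * t)} \<le> card {j. j < n \<and> Q j}"
proof (rule ccontr)
  assume "\<not> ?thesis"
  then have large: "card {j. j < n \<and> Q j} < g * card {t. t < r \<and> Q (u + g * t)}" if "u < g" for u
    using that by (meson not_le)
  let ?S = "SIGMA u:{..<g}. {t. t < r \<and> Q (u + g * t)}"
  have "inj_on (\<lambda>(u, t). u + g * t) ?S"
  proof (rule inj_onI, clarsimp)
    fix u t u' t' assume h: "u < g" "u' < g" "u + g * t = u' + g * t'"
    then have "(u + g * t) mod g = (u' + g * t') mod g" by simp
    then have "u = u'" using h(1,2) by simp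
    then show "u = u' \<and> t = t'" using h by simp
  qed
  moreover have "(\<lambda>(u, t). u + g * t) ` ?S \<subseteq> {j. j < n \<and> Q j}"
  proof clarsimp
    fix u t assume "u < g" "t < r"
    then have "u + g * t < g * Suc t" by simp
    also have "\<dots> \<le> g * r" using \<open>t < r\<close> by (intro mult_le_mono) auto
    finally show "u + g * t < n" using assms by simp
  qed
  ultimately have "card ?S \<le> card {j. j < n \<and> Q j}"
    by (rule card_inj_on_le) simp
  then have "g * (\<Sum>u<g. card {t. t < r \<and> Q (u + g * t)}) \<le> g * card {j. j < n \<and> Q j}"
    by (simp add: card_SigmaI)
  moreover have "(\<Sum>u<g. card {j. j < n \<and> Q j}) < (\<Sum>u<g. g * card {t. t < r \<and> Q (u + g * t)})"
    using large assms by (intro sum_strict_mono) (auto simp: lessThan_empty_iff)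
  ultimately show False by (simp add: sum_distrib_left)
qed

section \<open>Stretched exponential versus polynomial decay\<close>

lemma polynomial_decay_of_eventually:
  fixes f :: "nat \<Rightarrow> real"
  assumes "\<beta> > 0" "\<And>n. f n \<le> 1" "eventually (\<lambda>n. f n \<le> 1 / real n powr \<beta>) sequentially"
  shows "\<exists>d>0. \<forall>n\<ge>1. f n \<le> d / real n powr \<beta>"
proof -
  obtain n1 where n1: "\<And>n. n \<ge> n1 \<Longrightarrow> f n \<le> 1 / real n powr \<beta>"
    using assms(3) by (auto simp: eventually_sequentially)
  let ?d = "max 1 (real n1 powr \<beta>)"
  have "f n \<le> ?d / real n powr \<beta>" if "n \<ge> 1" for n
  proof (cases "n \<ge> n1")
    case True
    have "f n \<le> 1 / real n powr \<beta>" using n1 True by simp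
    also have "\<dots> \<le> ?d / real n powr \<beta>" by (intro divide_right_mono) auto
    finally show ?thesis .
  next
    case False
    have "real n powr \<beta> \<le> ?d" using False assms(1) by (intro max.coboundedI2 powr_mono2) auto
    then have "1 \<le> ?d / real n powr \<beta>" using that by simp
    then show ?thesis using assms(2)[of n] by linarith
  qed
  then show ?thesis by (intro exI[of _ ?d]) auto
qed

text \<open>
  The expression is the union bound over residue classes modulo the integer square root: \<open>l\<close> is the
  length of the observed window, which has to be subtracted from the gap.
\<close>

lemma polynomial_decay_of_stretched_exp:
  fixes \<eta> a b c \<beta> :: real
  assumes "\<eta> > 0" "b > 0" "c > 0" "\<beta> > 0"
  shows "eventually (\<lambda>n. real n * (exp (- \<eta> * real (floor_sqrt n)) +
      a * exp (- b * real (floor_sqrt n - l) powr c)) \<le> 1 / real n powr \<beta>) sequentially"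
proof -
  define C where "C = 2 * (\<beta> + 1)"
  have C: "C > 0" using assms by (simp add: C_def)
  have 1: "((\<lambda>x::real. (x + 1) powr C * exp (- \<eta> * x)) \<longlongrightarrow> 0) at_top"
    using assms(1) C by real_asymp
  have 2: "((\<lambda>x::real. (x + real l + 1) powr C * exp (- b * x powr c)) \<longlongrightarrow> 0) at_top"
    using assms(2,3) C by real_asymp
  have floor_sqrt: "filterlim floor_sqrt at_top sequentially"
    unfolding filterlim_at_top eventually_sequentially
    by (metis floor_sqrt_inverse_power2 mono_floor_sqrt')
  then have g: "filterlim (\<lambda>n. real (floor_sqrt n)) at_top sequentially"
    by (rule filterlim_compose[OF filterlim_real_sequentially])
  have gl: "filterlim (\<lambda>n. real (floor_sqrt n) - real l) at_top sequentially"
    using filterlim_tendsto_add_at_top[OF tendsto_const g, of "- real l"] by simp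
  have "((\<lambda>n. (real (floor_sqrt n) + 1) powr C * exp (- \<eta> * real (floor_sqrt n)) +
      a * ((real (floor_sqrt n) - real l + real l + 1) powr C * exp (- b * (real (floor_sqrt n) - real l) powr c)))
      \<longlongrightarrow> 0 + a * 0) sequentially"
    by (intro tendsto_add tendsto_mult tendsto_const filterlim_compose[OF 1 g] filterlim_compose[OF 2 gl])
  then have "eventually (\<lambda>n. (real (floor_sqrt n) + 1) powr C * exp (- \<eta> * real (floor_sqrt n)) +
      a * ((real (floor_sqrt n) - real l + real l + 1) powr C * exp (- b * (real (floor_sqrt n) - real l) powr c)) < 1)
      sequentially"
    by (auto dest: order_tendstoD(2)[where a = 1])
  moreover have "eventually (\<lambda>n. l < floor_sqrt n) sequentially"
    using floor_sqrt[unfolded filterlim_at_top, rule_format, of "Suc l"] by (simp add: Suc_le_eq)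
  moreover have "eventually (\<lambda>n. n \<ge> (1::nat)) sequentially"
    by (rule eventually_ge_at_top)
  ultimately show ?thesis
  proof eventually_elim
    case (elim n)
    let ?g = "floor_sqrt n"
    let ?s = "exp (- \<eta> * real ?g) + a * exp (- b * real (?g - l) powr c)"
    have bound: "(real ?g + 1) powr C * ?s < 1"
      using elim(1,2) by (simp add: algebra_simps of_nat_diff)
    \<comment> \<open>One factor \<open>n\<close> comes from the prefactor and \<open>n powr \<beta>\<close> from the target; both are
        absorbed by the power \<open>C = 2 * (\<beta> + 1)\<close> of \<open>?g + 1 > sqrt n\<close>.\<close>
    have "n < (?g + 1)\<^sup>2" using Suc_floor_sqrt_power2_gt[of n] by simp
    then have "real n < (real ?g + 1)\<^sup>2"
      by (metis of_nat_less_iff of_nat_power of_nat_add of_nat_1)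
    then have "real n powr (\<beta> + 1) \<le> ((real ?g + 1)\<^sup>2) powr (\<beta> + 1)"
      using assms(4) by (intro powr_mono2) auto
    also have "\<dots> = (real ?g + 1) powr C"
      by (simp add: C_def powr_powr flip: powr_numeral)
    finally have n: "real n powr \<beta> * real n \<le> (real ?g + 1) powr C"
      using elim(3) by (simp add: powr_add)
    have "real n powr \<beta> * (real n * ?s) \<le> 1"
    proof (cases "?s \<ge> 0")
      case True
      then show ?thesis using mult_right_mono[OF n True] bound by (simp add: mult.assoc)
    next
      case False
      then show ?thesis 
        by (smt (verit) mult_nonneg_nonpos of_nat_0_le_iff powr_ge_zero)
    qed
    then show ?case using elim(3) by (simp add: field_simps)
  qed
qed

text \<open>
  How many occurrences can be tolerated: \<open>\<kappa>\<close> is chosen so that \<open>2 powr \<kappa> = 1 / sqrt q\<close>, hence the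
  factor \<open>2 ^ m\<close> eats up at most half of the exponential rate of \<open>q ^ r\<close>.
\<close>

lemma exists_exponential_tradeoff:
  fixes q :: real
  assumes "0 < q" "q < 1"
  obtains \<kappa> \<eta> where "\<kappa> > 0" "\<eta> > 0"
    "\<And>(r::nat) (m::nat). real m \<le> \<kappa> * real r \<Longrightarrow> 2 ^ m * q ^ r \<le> exp (- \<eta> * real r)"
proof (rule that[of "- ln q / 2 / ln 2" "- ln q / 2"])
  let ?\<eta> = "- ln q / 2"
  show pos: "?\<eta> > 0" using assms by simp
  then show "?\<eta> / ln 2 > 0" by (intro divide_pos_pos) auto
  fix r m :: nat assume m: "real m \<le> ?\<eta> / ln 2 * real r"
  then have "real m * ln 2 \<le> ?\<eta> * real r" by (simp add: field_simps)
  then have "exp (real m * ln 2 + real r * ln q) \<le> exp (- ?\<eta> * real r)" by (simp add: field_simps)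
  moreover have "exp (real m * ln 2 + real r * ln q) = 2 ^ m * q ^ r"
    using assms by (simp add: exp_add exp_of_nat_mult)
  ultimately show "2 ^ m * q ^ r \<le> exp (- ?\<eta> * real r)" by simp
qed

section \<open>Visits of a mixing process to a cylinder\<close>

text \<open>
  The window extends to the right of \<open>j\<close> only, so that it makes sense at every time \<open>j\<close> of
  the one sided process.
\<close>

definition cyl_event :: "'w measure \<Rightarrow> (nat \<Rightarrow> 'w \<Rightarrow> 'y) \<Rightarrow> (nat \<Rightarrow> 'y set) \<Rightarrow> nat \<Rightarrow> nat \<Rightarrow> 'w set" where
  "cyl_event M \<zeta> V l j = {w \<in> space M. \<forall>k\<le>l. \<zeta> (j + k) w \<in> V k}"

lemma sigma_algebra_sigma_gen_by:
  "sigma_algebra (space M) (sigma_gen_by M \<zeta> I)"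
  unfolding sigma_gen_by_def by (rule sigma_algebra_sigma_sets) auto

lemma cyl_event_in_sigma_gen_by:
  assumes V: "\<And>k. V k \<in> sets borel" and I: "{j..j + l} \<subseteq> I"
  shows "cyl_event M \<zeta> V l j \<in> sigma_gen_by M \<zeta> I"
proof -
  interpret sigma_algebra "space M" "sigma_gen_by M \<zeta> I" by (rule sigma_algebra_sigma_gen_by)
  have "cyl_event M \<zeta> V l j = (\<Inter>k\<in>{..l}. \<zeta> (j + k) -` V k \<inter> space M)"
    unfolding cyl_event_def by auto
  also have "\<dots> \<in> sigma_gen_by M \<zeta> I"
  proof (rule finite_INT)
    fix k assume "k \<in> {..l}"
    then have "j + k \<in> I" using I by auto
    then show "\<zeta> (j + k) -` V k \<inter> space M \<in> sigma_gen_by M \<zeta> I"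
      unfolding sigma_gen_by_def using V by (intro sigma_sets.Basic) auto
  qed auto
  finally show ?thesis .
qed

lemma sets_cyl_event [measurable]:
  assumes [measurable]: "\<And>n. \<zeta> n \<in> borel_measurable M" "\<And>k. V k \<in> sets borel"
  shows "cyl_event M \<zeta> V l j \<in> sets M"
  unfolding cyl_event_def by measurable

text \<open>
  Windows of length \<open>l\<close> at distance \<open>g\<close> leave a gap of \<open>g - l\<close>. The starting time \<open>h\<close> exceeds
  \<open>g\<close> because mixing compares the future with the past from time 1 on, and the past has to be
  nonempty already for the first window.
\<close>

lemma prob_few_visits_spaced_le:
  fixes \<zeta> :: "nat \<Rightarrow> 'w \<Rightarrow> 'y::topological_space"
  assumes "prob_space M" and \<zeta>: "\<And>n. \<zeta> n \<in> borel_measurable M"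
    and V: "\<And>k. V k \<in> sets borel"
    and mix: "\<And>n k A B. n \<ge> 1 \<Longrightarrow> k \<ge> 1 \<Longrightarrow> A \<in> sigma_gen_by M \<zeta> {1..k} \<Longrightarrow>
        B \<in> sigma_gen_by M \<zeta> {k + n..} \<Longrightarrow>
        \<bar>measure M (A \<inter> B) - measure M A * measure M B\<bar> \<le> \<phi> n"
    and p: "0 < p" "\<And>j. p \<le> measure M (cyl_event M \<zeta> V l j)"
    and "l < g" "g < h"
  shows "measure M {w \<in> space M. card {t. t < r \<and> w \<in> cyl_event M \<zeta> V l (h + g * t)} \<le> m}
     \<le> 2 ^ m * (1 - p / 2) ^ r + real r * \<phi> (g - l)"
proof -
  interpret prob_space M by fact
  show ?thesis
  proof (rule prob_few_occurrences_le)
    show "cyl_event M \<zeta> V l (h + g * t) \<in> events" for t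
      using \<zeta> V by measurable
    show "0 \<le> p" using p by simp
    show "p \<le> 1" using p(2)[of 0] prob_le_1 order_trans by blast
  next
    fix t A
    let ?G = "\<lambda>t. cyl_event M \<zeta> V l (h + g * t)"
    assume A: "A \<in> sigma_sets (space M) (?G ` {..<t})"
    define k where "k = h + g * t - (g - l)"
    have k: "k \<ge> 1" "k + (g - l) = h + g * t" using assms(7,8) by (auto simp: k_def)
    interpret past: sigma_algebra "space M" "sigma_gen_by M \<zeta> {1..k}"
      by (rule sigma_algebra_sigma_gen_by)
    have "?G t' \<in> sigma_gen_by M \<zeta> {1..k}" if "t' < t" for t'
    proof (rule cyl_event_in_sigma_gen_by[OF V])
      have "g * Suc t' \<le> g * t" using that by (intro mult_le_mono) auto
      then show "{h + g * t'..h + g * t' + l} \<subseteq> {1..k}"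
        using assms(7,8) by (auto simp: k_def)
    qed
    then have "A \<in> sigma_gen_by M \<zeta> {1..k}"
      using A past.sigma_sets_subset[of "?G ` {..<t}"] by blast
    moreover have "?G t \<in> sigma_gen_by M \<zeta> {k + (g - l)..}"
      unfolding k(2) by (rule cyl_event_in_sigma_gen_by[OF V]) auto
    ultimately have "\<bar>prob (A \<inter> ?G t) - prob A * prob (?G t)\<bar> \<le> \<phi> (g - l)"
      using mix[of "g - l" k A "?G t"] k(1) assms(7) by simp
    moreover have "p * prob A \<le> prob A * prob (?G t)"
      using mult_left_mono[OF p(2)[of "h + g * t"], of "prob A"] by (simp add: mult.commute)
    ultimately show "p * prob A - \<phi> (g - l) \<le> prob (A \<inter> ?G t)"
      by linarith
  qed
qed

text \<open>
  The decisive estimate. The observation starts at time \<open>n + 1\<close> so that every residue class starts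
  later than the gap \<open>g \<le> n\<close>; this is harmless because \<open>p\<close> bounds the probability at every time.
  The constant \<open>\<kappa>\<close> is found before \<open>\<beta>\<close> is given: it depends on \<open>p\<close> alone.
\<close>

lemma prob_few_visits_polynomial_decay:
  fixes \<zeta> :: "nat \<Rightarrow> 'w \<Rightarrow> 'y::topological_space"
  assumes "prob_space M" and \<zeta>: "\<And>n. \<zeta> n \<in> borel_measurable M"
    and V: "\<And>k. V k \<in> sets borel"
    and mix: "stretched_exp_alpha_mixing M \<zeta>"
    and p: "0 < p" "\<And>j. p \<le> measure M (cyl_event M \<zeta> V l j)"
  shows "\<exists>\<kappa>>0. \<forall>\<beta>>0. \<exists>d>0. \<forall>n\<ge>1.
    measure M {w \<in> space M. real (card {j. j < n \<and> w \<in> cyl_event M \<zeta> V l (n + 1 + j)}) \<le> \<kappa> * real n}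
      \<le> d / real n powr \<beta>"
proof -
  interpret prob_space M by fact
  let ?G = "cyl_event M \<zeta> V l"
  note [measurable] = \<zeta> V
  obtain a b c :: real where abc: "a > 0" "b > 0" "c > 0" and
    mix_all: "\<forall>n\<ge>1. \<forall>k\<ge>1. \<forall>A \<in> sigma_gen_by M \<zeta> {1..k}. \<forall>B \<in> sigma_gen_by M \<zeta> {k + n..}.
        \<bar>measure M (A \<inter> B) - measure M A * measure M B\<bar> \<le> a * exp (- b * real n powr c)"
    using mix unfolding stretched_exp_alpha_mixing_def by (elim exE conjE)
  have mix: "n \<ge> 1 \<Longrightarrow> k \<ge> 1 \<Longrightarrow> A \<in> sigma_gen_by M \<zeta> {1..k} \<Longrightarrow>
        B \<in> sigma_gen_by M \<zeta> {k + n..} \<Longrightarrow>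
        \<bar>measure M (A \<inter> B) - measure M A * measure M B\<bar> \<le> a * exp (- b * real n powr c)" for n k A B
    using mix_all by simp
  have "p \<le> 1" using p(2)[of 0] prob_le_1 order_trans by blast
  then obtain \<kappa> \<eta> where \<kappa>: "\<kappa> > 0" and \<eta>: "\<eta> > 0" and
    tradeoff: "\<And>(r::nat) (m::nat). real m \<le> \<kappa> * real r \<Longrightarrow> 2 ^ m * (1 - p / 2) ^ r \<le> exp (- \<eta> * real r)"
    using exists_exponential_tradeoff[of "1 - p / 2"] p(1) by auto
  define f where "f n = prob {w \<in> space M. real (card {j. j < n \<and> w \<in> ?G (n + 1 + j)}) \<le> \<kappa> / 2 * real n}" for n
  have f_le: "f n \<le> real n * (exp (- \<eta> * real (floor_sqrt n)) + a * exp (- b * real (floor_sqrt n - l) powr c))"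
    if l: "l < floor_sqrt n" for n
  proof -
    define g where "g = floor_sqrt n"
    define r where "r = n div g"
    define m where "m = nat \<lfloor>\<kappa> * real r\<rfloor>"
    define \<alpha> where "\<alpha> = a * exp (- b * real (g - l) powr c)"
    have g: "g \<ge> 1" "l < g" using l by (auto simp: g_def)
    have "g * g \<le> n" using floor_sqrt_power2_le[of n] by (simp add: g_def power2_eq_square)
    then have "g \<le> r" using g(1) by (simp add: r_def less_eq_div_iff_mult_less_eq)
    have gr: "g * r \<le> n" by (simp add: r_def)
    have "g \<le> n" using \<open>g * g \<le> n\<close> g(1) by (metis le_trans le_square)
    \<comment> \<open>Together the \<open>g\<close> classes of \<open>r\<close> members miss fewer than \<open>g\<close> of the times below \<open>n\<close>,
        hence cover at least half of them; this is why the total is compared with \<open>\<kappa> / 2\<close>.\<close>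
    have "n < g * r + g"
      using mult_div_mod_eq[of g n] mod_less_divisor[of g n] g(1) unfolding r_def by linarith
    moreover have "g \<le> g * r" using \<open>g \<le> r\<close> g(1) by simp
    ultimately have "n \<le> 2 * (g * r)" by linarith
    then have n_le: "real n \<le> 2 * (real g * real r)" by (metis of_nat_le_iff of_nat_mult of_nat_numeral)
    have m: "real m \<le> \<kappa> * real r" using \<kappa> by (simp add: m_def)
    define F where "F u = {w \<in> space M. card {t. t < r \<and> w \<in> ?G (n + 1 + u + g * t)} \<le> m}" for u
    have [measurable]: "F u \<in> events" for u unfolding F_def by (rule sets_Collect_card_occurrences) measurable
    have sub: "{w \<in> space M. real (card {j. j < n \<and> w \<in> ?G (n + 1 + j)}) \<le> \<kappa> / 2 * real n} \<subseteq> (\<Union>u<g. F u)"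
    proof clarify
      fix w assume w: "w \<in> space M" and few: "real (card {j. j < n \<and> w \<in> ?G (n + 1 + j)}) \<le> \<kappa> / 2 * real n"
      obtain u where u: "u < g" and
        "g * card {t. t < r \<and> w \<in> ?G (n + 1 + (u + g * t))} \<le> card {j. j < n \<and> w \<in> ?G (n + 1 + j)}"
        using exists_sparse_residue_class[OF g(1) gr, of "\<lambda>j. w \<in> ?G (n + 1 + j)"] by blast
      then have "real (g * card {t. t < r \<and> w \<in> ?G (n + 1 + (u + g * t))}) \<le> \<kappa> / 2 * real n"
        using few of_nat_mono order_trans by blast
      then have "real g * real (card {t. t < r \<and> w \<in> ?G (n + 1 + (u + g * t))}) \<le> \<kappa> / 2 * real n"
        by simp
      also have "\<dots> \<le> real g * (\<kappa> * real r)" using mult_left_mono[OF n_le, of "\<kappa> / 2"] \<kappa> by (simp add: mult_ac)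
      finally have "real (card {t. t < r \<and> w \<in> ?G (n + 1 + (u + g * t))}) \<le> \<kappa> * real r"
        using g(1) by simp
      then have "card {t. t < r \<and> w \<in> ?G (n + 1 + (u + g * t))} \<le> m"
        unfolding m_def by (simp add: le_nat_floor)
      then show "w \<in> (\<Union>u<g. F u)" using u w unfolding F_def by (auto simp: add.assoc)
    qed
    have "f n \<le> prob (\<Union>u<g. F u)"
      unfolding f_def by (rule finite_measure_mono[OF sub]) auto
    also have "\<dots> \<le> (\<Sum>u<g. prob (F u))" by (rule finite_measure_subadditive_finite) auto
    also have "\<dots> \<le> (\<Sum>u<g. exp (- \<eta> * real r) + real r * \<alpha>)"
    proof (rule sum_mono)
      fix u
      have "prob (F u) \<le> 2 ^ m * (1 - p / 2) ^ r + real r * \<alpha>"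
        unfolding F_def \<alpha>_def
        by (rule prob_few_visits_spaced_le[OF \<open>prob_space M\<close> \<zeta> V mix p g(2)])
          (use \<open>g \<le> n\<close> in auto)
      then show "prob (F u) \<le> exp (- \<eta> * real r) + real r * \<alpha>" using tradeoff[OF m] by linarith
    qed
    also have "\<dots> = real g * exp (- \<eta> * real r) + real (g * r) * \<alpha>" by (simp add: algebra_simps)
    also have "\<dots> \<le> real n * exp (- \<eta> * real g) + real n * \<alpha>"
      using \<open>g \<le> n\<close> \<open>g \<le> r\<close> of_nat_mono[OF gr, where 'a = real] \<eta> abc(1) unfolding \<alpha>_def
      by (intro add_mono mult_mono) auto
    finally show ?thesis by (simp add: g_def \<alpha>_def ring_distribs)
  qed
  have "\<exists>d>0. \<forall>n\<ge>1. f n \<le> d / real n powr \<beta>" if \<beta>: "\<beta> > 0" for \<beta>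
  proof (rule polynomial_decay_of_eventually[OF \<beta>])
    show "f n \<le> 1" for n unfolding f_def by (rule prob_le_1)
    have "eventually (\<lambda>n. l < floor_sqrt n) sequentially"
      unfolding eventually_sequentially
      by (metis floor_sqrt_inverse_power2 mono_floor_sqrt' Suc_le_eq)
    with polynomial_decay_of_stretched_exp[OF \<eta> abc(2,3) \<beta>, of a l]
    show "eventually (\<lambda>n. f n \<le> 1 / real n powr \<beta>) sequentially"
      by eventually_elim (use f_le order_trans in blast)
  qed
  then show ?thesis using \<kappa> unfolding f_def by (intro exI[of _ "\<kappa> / 2"]) auto
qed

section \<open>Cylinders inside the orbit set\<close>

lemma summable_on_inverse_power_abs_int: "(\<lambda>n::int. 1 / 2 ^ nat \<bar>n\<bar> :: real) summable_on UNIV"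
proof -
  let ?g = "\<lambda>n::int. 1 / 2 ^ nat \<bar>n\<bar> :: real"
  have geo: "(\<lambda>k::nat. (1/2::real) ^ k) summable_on UNIV"
    by (rule norm_summable_imp_summable_on) simp
  have 1: "?g summable_on (range int)"
    by (subst summable_on_reindex) (use geo in \<open>auto simp: o_def power_one_over inj_on_def\<close>)
  have 2: "?g summable_on (range (\<lambda>k. - int k))"
    by (subst summable_on_reindex) (use geo in \<open>auto simp: o_def power_one_over inj_on_def\<close>)
  have "UNIV = range int \<union> (range (\<lambda>k. - int k) - range int)"
    by (auto simp: image_iff) (metis int_cases2)
  moreover have "?g summable_on (range (\<lambda>k. - int k) - range int)"
    using 2 by (rule summable_on_subset_banach) auto
  ultimately show ?thesis
    using summable_on_Un_disjoint[OF 1] by (metis Diff_disjoint)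
qed

text \<open>
  The weights outside a finite set \<open>F\<close> of indices sum to at most \<open>\<epsilon> / 4\<close>, and the distances there
  are at most 1; on \<open>F\<close> the distances are below \<open>\<delta>\<close>, chosen small against the total weight \<open>S\<close>.
  The radius does not depend on the centre, which allows one window for all points of the orbit.
\<close>

lemma dist_seq_ball_contains_cylinder:
  fixes x :: "int \<Rightarrow> 'y::metric_space"
  assumes diam: "\<And>x y :: 'y. dist x y \<le> 1" and "\<epsilon> > 0"
  shows "\<exists>(N::nat) \<delta>. \<delta> > 0 \<and> (\<forall>x y :: int \<Rightarrow> 'y.
    (\<forall>m. \<bar>m\<bar> \<le> int N \<longrightarrow> dist (x m) (y m) < \<delta>) \<longrightarrow> dist_seq x y < \<epsilon>)"
proof -
  let ?g = "\<lambda>n::int. 1 / 2 ^ nat \<bar>n\<bar> :: real"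
  note sum_g = summable_on_inverse_power_abs_int
  define S where "S = infsum ?g UNIV"
  have "S \<ge> 0" unfolding S_def by (rule infsum_nonneg) simp
  obtain F :: "int set" where F: "finite F" "dist (sum ?g F) S \<le> \<epsilon> / 4"
    using infsum_finite_approximation[OF sum_g, of "\<epsilon> / 4"] \<open>\<epsilon> > 0\<close> unfolding S_def by auto
  have sum_co: "?g summable_on (- F)" using sum_g by (rule summable_on_subset_banach) auto
  have "S = sum ?g F + infsum ?g (- F)"
    using infsum_Un_disjoint[of ?g F "- F"] F(1) sum_co by (simp add: S_def Un_commute)
  then have tail: "infsum ?g (- F) \<le> \<epsilon> / 4" using F(2) by (simp add: dist_real_def)
  define \<delta> where "\<delta> = \<epsilon> / (4 * (S + 1))"
  have \<delta>: "\<delta> > 0" "\<delta> * S \<le> \<epsilon> / 4"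
    using \<open>\<epsilon> > 0\<close> \<open>S \<ge> 0\<close> by (auto simp: \<delta>_def field_simps)
  define N where "N = Max (insert 0 ((\<lambda>m. nat \<bar>m\<bar>) ` F))"
  have N: "\<bar>m\<bar> \<le> int N" if "m \<in> F" for m
  proof -
    have "nat \<bar>m\<bar> \<le> N" unfolding N_def using that F(1) by (intro Max_ge) auto
    then show ?thesis by linarith
  qed
  show ?thesis
  proof (intro exI[of _ N] exI[of _ \<delta>] conjI allI impI)
    fix x y :: "int \<Rightarrow> 'y" assume "\<forall>m. \<bar>m\<bar> \<le> int N \<longrightarrow> dist (x m) (y m) < \<delta>"
    then have close: "\<And>m. \<bar>m\<bar> \<le> int N \<Longrightarrow> dist (x m) (y m) < \<delta>" by blast
    let ?h = "\<lambda>n. \<delta> * ?g n + (if n \<in> F then 0 else ?g n)"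
    have tail_sum: "(\<lambda>n. if n \<in> F then 0 else ?g n) summable_on UNIV"
      using sum_co by (rule summable_on_cong_neutral[THEN iffD1, rotated -1]) auto
    have head_sum: "(\<lambda>n. \<delta> * ?g n) summable_on UNIV" using sum_g by (rule summable_on_cmult_right)
    have "dist_seq x y \<le> infsum ?h UNIV"
      unfolding dist_seq_def
    proof (rule infsum_mono)
      show "(\<lambda>n. dist (x n) (y n) / 2 ^ nat \<bar>n\<bar>) summable_on UNIV"
        by (rule summable_on_comparison_test[OF sum_g]) (use diam in \<open>auto intro!: divide_right_mono\<close>)
      show "?h summable_on UNIV" using head_sum tail_sum by (rule summable_on_add)
      fix n
      show "dist (x n) (y n) / 2 ^ nat \<bar>n\<bar> \<le> ?h n"
      proof (cases "n \<in> F")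
        case True
        then have "dist (x n) (y n) \<le> \<delta>" using close[OF N] by force
        then show ?thesis using True by (simp add: divide_right_mono)
      next
        case False
        have "dist (x n) (y n) / 2 ^ nat \<bar>n\<bar> \<le> ?g n" using diam by (intro divide_right_mono) auto
        moreover have "0 \<le> \<delta> * ?g n" using \<delta>(1) by simp
        ultimately show ?thesis using False by simp
      qed
    qed
    also have "\<dots> = \<delta> * S + infsum (\<lambda>n. if n \<in> F then 0 else ?g n) UNIV"
      using infsum_add[OF head_sum tail_sum] infsum_cmult_right'[of \<delta> ?g UNIV] by (simp add: S_def)
    also have "infsum (\<lambda>n. if n \<in> F then 0 else ?g n) UNIV = infsum ?g (- F)"
      by (rule infsum_cong_neutral) auto
    also have "\<delta> * S + infsum ?g (- F) < \<epsilon>" using \<delta>(2) tail \<open>\<epsilon> > 0\<close> by linarith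
    finally show "dist_seq x y < \<epsilon>" .
  qed (rule \<delta>(1))
qed

lemma lshift_funpow: "(lshift ^^ i) y = (\<lambda>m. y (m + int i))"
  by (induction i) (auto simp: lshift_def algebra_simps)

lemma periodic_point_shift:
  assumes "n0 \<ge> 1" and per: "\<And>i k. i < n0 \<Longrightarrow> \<omega>0 (int i + k * int n0) = a i"
  shows "\<omega>0 (m + k * int n0) = \<omega>0 m"
proof -
  have "\<omega>0 (m + k * int n0) = a (nat (m mod int n0))" for k
  proof -
    have "m + k * int n0 = int (nat (m mod int n0)) + (m div int n0 + k) * int n0"
      using \<open>n0 \<ge> 1\<close> by (simp add: algebra_simps)
    moreover have "nat (m mod int n0) < n0" using \<open>n0 \<ge> 1\<close> by (simp add: nat_less_iff)
    ultimately show ?thesis using per by presburger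
  qed
  from this[of k] this[of 0] show ?thesis by simp
qed

text \<open>
  By periodicity the neighborhood used at time \<open>i\<close>, indexed by \<open>i mod n0\<close>, is centred at the
  \<open>i\<close>-th shift of \<open>\<omega>0\<close> itself, so all \<open>s * n0\<close> conditions compare \<open>y\<close> with \<open>\<omega>0\<close> at the same
  coordinates. The window radius is a multiple of the period because it is later shifted to start at 0.
\<close>

lemma orbit_set_contains_cylinder:
  fixes \<omega>0 :: "int \<Rightarrow> 'y::metric_space"
  assumes diam: "\<And>x y :: 'y. dist x y \<le> 1" and "n0 \<ge> 1"
    and per: "\<And>i k. i < n0 \<Longrightarrow> \<omega>0 (int i + k * int n0) = a i"
    and nbhd: "\<forall>i<n0. seq_neighborhood ((lshift ^^ i) \<omega>0) (B i)"
  shows "\<exists>(L::nat) \<delta>. \<delta> > 0 \<and> n0 dvd L \<and>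
    {y. \<forall>m\<in>{- int L..int L}. y m \<in> ball (\<omega>0 m) \<delta>} \<subseteq> orbit_set B n0 s"
proof -
  have "\<exists>\<epsilon>>0. {y. dist_seq ((lshift ^^ i) \<omega>0) y < \<epsilon>} \<subseteq> B i" if "i < n0" for i
    using nbhd that unfolding seq_neighborhood_def by blast
  then obtain e where e: "\<And>i. i < n0 \<Longrightarrow> e i > 0"
    "\<And>i. i < n0 \<Longrightarrow> {y. dist_seq ((lshift ^^ i) \<omega>0) y < e i} \<subseteq> B i" by metis
  define \<epsilon> where "\<epsilon> = Min (e ` {..<n0})"
  have \<epsilon>: "\<epsilon> > 0" "\<And>i. i < n0 \<Longrightarrow> \<epsilon> \<le> e i"
    using e(1) \<open>n0 \<ge> 1\<close> by (auto simp: \<epsilon>_def Min_gr_iff lessThan_empty_iff)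
  obtain N :: nat and \<delta> :: real where \<delta>: "\<delta> > 0" and
    close: "\<forall>x y :: int \<Rightarrow> 'y. (\<forall>m. \<bar>m\<bar> \<le> int N \<longrightarrow> dist (x m) (y m) < \<delta>) \<longrightarrow> dist_seq x y < \<epsilon>"
    using dist_seq_ball_contains_cylinder[OF diam \<epsilon>(1)] by (elim exE conjE)
  have period: "\<omega>0 (m + k * int n0) = \<omega>0 m" for m k
    using \<open>n0 \<ge> 1\<close> per by (rule periodic_point_shift)
  define L where "L = (N + s) * n0"
  show ?thesis
  proof (intro exI[of _ L] exI[of _ \<delta>] conjI)
    show "n0 dvd L" by (simp add: L_def)
    show "{y. \<forall>m\<in>{- int L..int L}. y m \<in> ball (\<omega>0 m) \<delta>} \<subseteq> orbit_set B n0 s"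
    proof (clarsimp simp: orbit_set_def)
      fix y i assume y: "\<forall>m\<in>{- int L..int L}. dist (\<omega>0 m) (y m) < \<delta>" and i: "i < s * n0"
      have "N * 1 \<le> N * n0" using \<open>n0 \<ge> 1\<close> by (intro mult_le_mono) auto
      then have L: "N + i \<le> L" using i unfolding L_def add_mult_distrib by linarith
      have "i mod n0 < n0" using \<open>n0 \<ge> 1\<close> by simp
      have "dist_seq ((lshift ^^ (i mod n0)) \<omega>0) ((lshift ^^ i) y) < \<epsilon>"
      proof (rule close[rule_format])
        fix m :: int assume "\<bar>m\<bar> \<le> int N"
        then have "m + int i \<in> {- int L..int L}" using L by auto
        moreover have "\<omega>0 (m + int (i mod n0)) = \<omega>0 (m + int i)"
          using period[of "m + int (i mod n0)" "int (i div n0)"]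
          by (metis add.assoc mod_div_mult_eq of_nat_add of_nat_mult)
        ultimately show "dist ((lshift ^^ (i mod n0)) \<omega>0 m) ((lshift ^^ i) y m) < \<delta>"
          using y by (simp add: lshift_funpow)
      qed
      then show "(lshift ^^ i) y \<in> B (i mod n0)"
        using e(2)[OF \<open>i mod n0 < n0\<close>] \<epsilon>(2)[OF \<open>i mod n0 < n0\<close>] by auto
    qed
  qed (rule \<delta>)
qed

section \<open>Transfer between the shift and the process\<close>

text \<open>
  The law of the two sided shift is given on rectangles over the window \<open>{- N..N}\<close>; these generate
  the product sigma algebra of the window and are closed under intersection. The general form is
  needed because events about numbers of visits are not rectangles.
\<close>

lemma two_sided_shift_law_window:
  fixes \<zeta> :: "nat \<Rightarrow> 'w \<Rightarrow> 'y::topological_space" and N :: nat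
  assumes \<zeta>: "\<And>n. \<zeta> n \<in> borel_measurable M" and "prob_space M"
    and law: "two_sided_shift_law M \<zeta> P"
  defines "I \<equiv> {- int N..int N}"
  shows "distr P (Pi\<^sub>M I (\<lambda>_. borel)) (\<lambda>y. restrict y I) =
    distr M (Pi\<^sub>M I (\<lambda>_. borel)) (\<lambda>w. \<lambda>i\<in>I. \<zeta> (nat (i + int N)) w)"
proof (rule measure_eqI_PiM_finite[where A = "\<lambda>_. space (Pi\<^sub>M I (\<lambda>_. borel))"])
  interpret M: prob_space M by fact
  interpret P: prob_space P using law by (simp add: two_sided_shift_law_def)
  have sets_P[measurable_cong]: "sets P = sets (\<Pi>\<^sub>M i\<in>UNIV. borel)"
    using law by (simp add: two_sided_shift_law_def)
  then have space_P: "space P = UNIV" by (simp add: sets_eq_imp_space_eq space_PiM)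
  note [measurable] = \<zeta>
  have m1[measurable]: "(\<lambda>y. restrict y I) \<in> measurable P (Pi\<^sub>M I (\<lambda>_. borel))"
    by measurable
  have m2[measurable]: "(\<lambda>w. \<lambda>i\<in>I. \<zeta> (nat (i + int N)) w) \<in> measurable M (Pi\<^sub>M I (\<lambda>_. borel))"
    by measurable
  show "finite I" by (simp add: I_def)
  show "emeasure (distr P (Pi\<^sub>M I (\<lambda>_. borel)) (\<lambda>y. restrict y I)) (Pi\<^sub>E I A) =
      emeasure (distr M (Pi\<^sub>M I (\<lambda>_. borel)) (\<lambda>w. \<lambda>i\<in>I. \<zeta> (nat (i + int N)) w)) (Pi\<^sub>E I A)"
    if A: "\<And>i. i \<in> I \<Longrightarrow> A i \<in> sets borel" for A :: "int \<Rightarrow> 'y set"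
  proof -
    define A' where "A' i = (if i \<in> I then A i else UNIV)" for i
    have [measurable]: "Pi\<^sub>E I A \<in> sets (Pi\<^sub>M I (\<lambda>_. borel))"
      using A \<open>finite I\<close> by (intro sets_PiM_I_finite) auto
    have "measure P {y. \<forall>i\<in>I. y i \<in> A' i} =
        measure M {w \<in> space M. \<forall>i\<in>{0..2 * N}. \<zeta> i w \<in> A' (int i - int N)}"
    proof -
      have "\<forall>i. A' i \<in> sets borel" using A by (simp add: A'_def)
      then show ?thesis using law unfolding two_sided_shift_law_def I_def by blast
    qed
    also have "{w \<in> space M. \<forall>i\<in>{0..2 * N}. \<zeta> i w \<in> A' (int i - int N)} =
        (\<lambda>w. \<lambda>i\<in>I. \<zeta> (nat (i + int N)) w) -` Pi\<^sub>E I A \<inter> space M"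
    proof -
      have "(\<forall>i\<in>{0..2 * N}. \<zeta> i w \<in> A' (int i - int N)) \<longleftrightarrow>
          (\<forall>i\<in>I. \<zeta> (nat (i + int N)) w \<in> A i)" for w
      proof safe
        fix i assume h: "\<forall>i\<in>{0..2 * N}. \<zeta> i w \<in> A' (int i - int N)" and i: "i \<in> I"
        then show "\<zeta> (nat (i + int N)) w \<in> A i"
          using h[rule_format, of "nat (i + int N)"] by (auto simp: I_def A'_def)
      next
        fix i assume h: "\<forall>i\<in>I. \<zeta> (nat (i + int N)) w \<in> A i" and i: "i \<in> {0..2 * N}"
        then show "\<zeta> i w \<in> A' (int i - int N)"
          using h[rule_format, of "int i - int N"] by (auto simp: I_def A'_def)
      qed
      then show ?thesis by (auto simp: PiE_iff)
    qed
    also have "{y. \<forall>i\<in>I. y i \<in> A' i} = (\<lambda>y. restrict y I) -` Pi\<^sub>E I A \<inter> space P"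
      by (auto simp: space_P A'_def)
    finally show ?thesis
      unfolding P.emeasure_eq_measure M.emeasure_eq_measure emeasure_distr[OF m1 \<open>Pi\<^sub>E I A \<in> _\<close>]
        emeasure_distr[OF m2 \<open>Pi\<^sub>E I A \<in> _\<close>] by (rule arg_cong)
  qed
  show "range (\<lambda>_. space (Pi\<^sub>M I (\<lambda>_. borel))) \<subseteq> prod_algebra I (\<lambda>_. borel)"
    using \<open>finite I\<close> by (auto simp: space_PiM intro!: prod_algebraI_finite)
  show "emeasure (distr P (Pi\<^sub>M I (\<lambda>_. borel)) (\<lambda>y. restrict y I)) (space (Pi\<^sub>M I (\<lambda>_. borel))) \<noteq> \<infinity>" for i :: nat
    using P.prob_space_distr[OF m1] by (simp add: emeasure_distr P.emeasure_eq_measure)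
qed auto

lemma stationary_cylinder:
  fixes \<zeta> :: "nat \<Rightarrow> 'w \<Rightarrow> 'y::topological_space"
  assumes \<zeta>: "\<And>n. \<zeta> n \<in> borel_measurable M" and V: "\<And>k. V k \<in> sets borel"
    and "stationary M \<zeta>"
  shows "measure M {w \<in> space M. \<forall>k\<le>l. \<zeta> (j + k) w \<in> V k} = measure M {w \<in> space M. \<forall>k\<le>l. \<zeta> k w \<in> V k}"
proof -
  note [measurable] = \<zeta> V
  let ?S = "Pi\<^sub>M UNIV (\<lambda>_. borel) :: (nat \<Rightarrow> 'y) measure"
  have [measurable]: "(\<lambda>w n. \<zeta> (n + i) w) \<in> measurable M ?S" for i
    by (rule measurable_PiM_single') (auto simp: space_PiM)
  let ?C = "{y \<in> space ?S. \<forall>k\<le>l. y k \<in> V k}"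
  have C: "?C \<in> sets ?S" by measurable
  have shifted: "measure (distr M ?S (\<lambda>w n. \<zeta> (n + i) w)) ?C =
      measure M {w \<in> space M. \<forall>k\<le>l. \<zeta> (i + k) w \<in> V k}" for i
  proof -
    have "(\<lambda>w n. \<zeta> (n + i) w) -` ?C \<inter> space M = {w \<in> space M. \<forall>k\<le>l. \<zeta> (i + k) w \<in> V k}"
      by (auto simp: space_PiM add.commute)
    then show ?thesis by (simp add: measure_distr C)
  qed
  have "distr M ?S (\<lambda>w n. \<zeta> (n + j) w) = distr M ?S (\<lambda>w n. \<zeta> (n + 0) w)"
    using \<open>stationary M \<zeta>\<close> by (simp add: stationary_def)
  then show ?thesis using shifted[of j] shifted[of 0] by simp
qed

section \<open>Linear growth of the number of visits\<close>

theorem proposition5p5: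
  fixes M :: "'w measure"
    and \<zeta> :: "nat \<Rightarrow> 'w \<Rightarrow> 'y::metric_space"
    and P :: "(int \<Rightarrow> 'y) measure"
    and n0 :: nat and a :: "nat \<Rightarrow> 'y" and \<omega>0 :: "int \<Rightarrow> 'y"
  assumes "prob_space M"
    and "\<And>n. \<zeta> n \<in> borel_measurable M"
    and "\<And>x y :: 'y. dist x y \<le> 1"
    and "stationary M \<zeta>"
    and "stretched_exp_alpha_mixing M \<zeta>"
    and "two_sided_shift_law M \<zeta> P"
    and "n0 \<ge> 1"
    and "\<And>i k. i < n0 \<Longrightarrow> \<omega>0 (int i + k * int n0) = a i"
    and "\<And>(s::nat) (A :: nat \<Rightarrow> nat \<Rightarrow> 'y set). s \<ge> 1 \<Longrightarrow>
           (\<And>i j. i < n0 \<Longrightarrow> j \<in> {1..s} \<Longrightarrow> open (A i j) \<and> a i \<in> A i j) \<Longrightarrow>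
           measure M {w \<in> space M. \<forall>i<n0. \<forall>j\<in>{1..s}. \<zeta> (i + (j - 1) * n0) w \<in> A i j} > 0"
  shows "\<forall>(s::nat) (B :: nat \<Rightarrow> (int \<Rightarrow> 'y) set).
           s > 0 \<longrightarrow> (\<forall>i<n0. seq_neighborhood ((lshift ^^ i) \<omega>0) (B i)) \<longrightarrow>
           (\<exists>c>0. \<forall>\<beta>>0. \<exists>d>0. \<forall>n\<ge>1.
              \<comment> \<open>outer measure, since the neighborhoods need not be measurable;
                  it agrees with \<open>P\<close> on measurable events\<close>
              outer_measure_of P
                {\<omega>. (\<Sum>j<n. indicator (orbit_set B n0 s) ((lshift ^^ j) \<omega>)) \<le> c * real n}
              \<le> ennreal (d / real n powr \<beta>))"
proof (intro allI impI)
  fix s :: nat and B :: "nat \<Rightarrow> (int \<Rightarrow> 'y) set"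
  assume nbhd: "\<forall>i<n0. seq_neighborhood ((lshift ^^ i) \<omega>0) (B i)"
  interpret M: prob_space M by fact
  interpret P: prob_space P using assms(6) by (simp add: two_sided_shift_law_def)
  note \<zeta> = assms(2)
  have period: "\<omega>0 (m + k * int n0) = \<omega>0 m" for m k
    using assms(7,8) by (rule periodic_point_shift)
  obtain L :: nat and \<delta> :: real where \<delta>: "\<delta> > 0" and L: "n0 dvd L" and
    sub: "{y. \<forall>m\<in>{- int L..int L}. y m \<in> ball (\<omega>0 m) \<delta>} \<subseteq> orbit_set B n0 s"
  proof -
    have "\<exists>(L::nat) \<delta>. \<delta> > 0 \<and> n0 dvd L \<and>
        {y. \<forall>m\<in>{- int L..int L}. y m \<in> ball (\<omega>0 m) \<delta>} \<subseteq> orbit_set B n0 s"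
      using assms(3,7,8) nbhd by (rule orbit_set_contains_cylinder)
    with that show ?thesis by blast
  qed
  \<comment> \<open>The window \<open>{- L..L}\<close> moved to \<open>{0..2 * L}\<close>; the centres stay the same since \<open>n0\<close> divides \<open>L\<close>.\<close>
  define V where "V k = ball (\<omega>0 (int k)) \<delta>" for k :: nat
  have V: "V k \<in> sets borel" for k by (simp add: V_def)
  let ?E = "cyl_event M \<zeta> V (2 * L)"
  define p where "p = measure M (?E 0)"
  \<comment> \<open>\<open>2 * L + 1\<close> repetitions of the periodic word are more than enough to cover the window.\<close>
  have "0 < measure M {w \<in> space M. \<forall>i<n0. \<forall>j\<in>{1..2 * L + 1}. \<zeta> (i + (j - 1) * n0) w \<in> ball (a i) \<delta>}"
    by (rule assms(9)) (use \<delta> in auto)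
  also have "\<dots> \<le> p"
    unfolding p_def
  proof (rule M.finite_measure_mono)
    show "{w \<in> space M. \<forall>i<n0. \<forall>j\<in>{1..2 * L + 1}. \<zeta> (i + (j - 1) * n0) w \<in> ball (a i) \<delta>} \<subseteq> ?E 0"
    proof (clarsimp simp: cyl_event_def V_def simp del: mem_ball)
      fix w k assume h: "\<forall>i<n0. \<forall>j\<in>{Suc 0..Suc (2 * L)}. \<zeta> (i + (j - Suc 0) * n0) w \<in> ball (a i) \<delta>"
        and k: "k \<le> 2 * L"
      have mod: "k mod n0 < n0" using assms(7) by simp
      have "k div n0 \<le> 2 * L" using k div_le_dividend order_trans by blast
      then have "\<zeta> (k mod n0 + (Suc (k div n0) - Suc 0) * n0) w \<in> ball (a (k mod n0)) \<delta>"
        by (intro h[rule_format, OF mod]) auto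
      moreover have "\<omega>0 (int k) = a (k mod n0)"
        using assms(8)[OF mod, of "int (k div n0)"]
        by (metis mod_div_mult_eq of_nat_add of_nat_mult)
      ultimately show "\<zeta> k w \<in> ball (\<omega>0 (int k)) \<delta>" by simp
    qed
    show "?E 0 \<in> M.events" using \<zeta> V by (rule sets_cyl_event)
  qed
  finally have p: "0 < p" .
  have p_le: "p \<le> measure M (?E j)" for j
    using stationary_cylinder[where V = V, OF \<zeta> V assms(4), of "2 * L" j] by (simp add: p_def cyl_event_def)
  obtain \<kappa> where \<kappa>: "\<kappa> > 0" and decay: "\<forall>\<beta>>0. \<exists>d>0. \<forall>n\<ge>1.
      measure M {w \<in> space M. real (card {j. j < n \<and> w \<in> ?E (n + 1 + j)}) \<le> \<kappa> * real n} \<le> d / real n powr \<beta>"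
    using prob_few_visits_polynomial_decay[where V = V, OF assms(1) \<zeta> V assms(5) p p_le] by (elim exE conjE)
  have outer_le: "outer_measure_of P
        {\<omega>. (\<Sum>j<n. indicator (orbit_set B n0 s) ((lshift ^^ j) \<omega>)) \<le> \<kappa> * real n}
      \<le> ennreal (measure M {w \<in> space M. real (card {j. j < n \<and> w \<in> ?E (n + 1 + j)}) \<le> \<kappa> * real n})" for n
  proof -
    \<comment> \<open>Large enough to contain all windows at the times \<open>j < n\<close>; with the index shift by \<open>N\<close> the
        window at time \<open>j\<close> starts at \<open>j - L + N = n + 1 + j\<close>.\<close>
    define N where "N = n + 1 + L"
    define I where "I = {- int N..int N}"
    define H where "H z j \<longleftrightarrow> (\<forall>m\<in>{- int L..int L}. z (m + int j) \<in> ball (\<omega>0 m) \<delta>)" for z j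
    define S where "S = Pi\<^sub>M I (\<lambda>_. borel :: 'y measure)"
    define G where "G = {z \<in> space S. real (card {j. j < n \<and> H z j}) \<le> \<kappa> * real n}"
    have in_I: "m + int j \<in> I" if "m \<in> {- int L..int L}" "j < n" for m j
      using that by (auto simp: I_def N_def)
    have H_restrict: "H (restrict z I) j = H z j" if "j < n" for z j
      using in_I[OF _ that] by (auto simp: H_def)
    have card_H: "card {j. j < n \<and> H (restrict z I) j} = card {j. j < n \<and> H z j}" for z
      using H_restrict by (intro arg_cong[where f = card]) blast
    have sets_H: "{z \<in> space S. H z j} \<in> sets S" if "j < n" for j
    proof -
      have "{z \<in> space S. z (m + int j) \<in> ball (\<omega>0 m) \<delta>} \<in> sets S" if "m \<in> {- int L..int L}" for m
      proof -
        have "(\<lambda>z. z (m + int j)) \<in> borel_measurable S"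
          unfolding S_def using in_I[OF that \<open>j < n\<close>] by (rule measurable_component_singleton)
        from measurable_sets[OF this, of "ball (\<omega>0 m) \<delta>"] show ?thesis
          by (simp add: vimage_def Int_def conj_commute del: mem_ball)
      qed
      then show ?thesis unfolding H_def by (intro sets.sets_Collect_finite_All) auto
    qed
    have G: "G \<in> sets S"
    proof -
      have "{z \<in> space S. (\<lambda>k. real k \<le> \<kappa> * real n) (card {j. j < n \<and> z \<in> {z \<in> space S. H z j}})} \<in> sets S"
        using sets_H by (rule sets_Collect_card_occurrences)
      also have "{z \<in> space S. (\<lambda>k. real k \<le> \<kappa> * real n) (card {j. j < n \<and> z \<in> {z \<in> space S. H z j}})} = G"
        unfolding G_def mem_Collect_eq by (intro Collect_cong conj_cong refl) (simp only: simp_thms)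
      finally show ?thesis .
    qed
    have sets_P: "sets P = sets (\<Pi>\<^sub>M i\<in>UNIV. borel)"
      using assms(6) by (simp add: two_sided_shift_law_def)
    then have space_P: "space P = UNIV" by (simp add: sets_eq_imp_space_eq space_PiM)
    have restr: "(\<lambda>y. restrict y I) \<in> measurable P S"
      unfolding S_def measurable_cong_sets[OF sets_P refl] by (rule measurable_restrict_subset) simp
    have window: "(\<lambda>w. \<lambda>i\<in>I. \<zeta> (nat (i + int N)) w) \<in> measurable M S"
      unfolding S_def using \<zeta> by measurable
    have "{\<omega>. (\<Sum>j<n. indicator (orbit_set B n0 s) ((lshift ^^ j) \<omega>)) \<le> \<kappa> * real n}
        \<subseteq> (\<lambda>y. restrict y I) -` G \<inter> space P"
    proof clarify
      fix y assume few: "(\<Sum>j<n. indicator (orbit_set B n0 s) ((lshift ^^ j) y)) \<le> \<kappa> * real n"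
      have "real (card {j. j < n \<and> H y j}) = (\<Sum>j<n. indicator {j. H y j} j)"
        by (simp add: indicator_def sum.If_cases Int_def lessThan_def)
      also have "\<dots> \<le> (\<Sum>j<n. indicator (orbit_set B n0 s) ((lshift ^^ j) y))"
      proof (rule sum_mono)
        fix j
        have "H y j \<Longrightarrow> (lshift ^^ j) y \<in> orbit_set B n0 s"
          using sub by (auto simp: H_def lshift_funpow)
        then show "indicator {j. H y j} j \<le> (indicator (orbit_set B n0 s) ((lshift ^^ j) y) :: real)"
          by (auto simp: indicator_def)
      qed
      finally have "real (card {j. j < n \<and> H (restrict y I) j}) \<le> \<kappa> * real n"
        using few card_H[of y] by linarith
      then show "y \<in> (\<lambda>y. restrict y I) -` G \<inter> space P"
        by (simp add: G_def S_def space_PiM space_P)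
    qed
    then have "outer_measure_of P
        {\<omega>. (\<Sum>j<n. indicator (orbit_set B n0 s) ((lshift ^^ j) \<omega>)) \<le> \<kappa> * real n}
        \<le> outer_measure_of P ((\<lambda>y. restrict y I) -` G \<inter> space P)"
      by (rule outer_measure_of_mono)
    also have "\<dots> = emeasure (distr P S (\<lambda>y. restrict y I)) G"
      using measurable_sets[OF restr G] by (simp add: emeasure_distr[OF restr G])
    also have "\<dots> = emeasure (distr M S (\<lambda>w. \<lambda>i\<in>I. \<zeta> (nat (i + int N)) w)) G"
      unfolding S_def I_def using two_sided_shift_law_window[OF \<zeta> assms(1,6), of N] by simp
    also have "\<dots> = emeasure M ((\<lambda>w. \<lambda>i\<in>I. \<zeta> (nat (i + int N)) w) -` G \<inter> space M)"
      by (rule emeasure_distr[OF window G])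
    also have "(\<lambda>w. \<lambda>i\<in>I. \<zeta> (nat (i + int N)) w) -` G \<inter> space M =
        {w \<in> space M. real (card {j. j < n \<and> w \<in> ?E (n + 1 + j)}) \<le> \<kappa> * real n}"
    proof -
      have "H (\<lambda>i. \<zeta> (nat (i + int N)) w) j \<longleftrightarrow> w \<in> ?E (n + 1 + j)" if w: "w \<in> space M" for w j
      proof -
        obtain q where q: "L = q * n0" using L by (metis dvdE mult.commute)
        have V': "V k = ball (\<omega>0 (int k - int L)) \<delta>" for k
          using period[of "int k - int L" "int q"] by (simp add: V_def q)
        have "w \<in> ?E (n + 1 + j) \<longleftrightarrow>
            (\<forall>k\<le>2 * L. \<zeta> (n + 1 + j + k) w \<in> ball (\<omega>0 (int k - int L)) \<delta>)"
          using w by (simp add: cyl_event_def V')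
        also have "\<dots> \<longleftrightarrow> H (\<lambda>i. \<zeta> (nat (i + int N)) w) j"
          unfolding H_def
        proof safe
          fix m assume h: "\<forall>k\<le>2 * L. \<zeta> (n + 1 + j + k) w \<in> ball (\<omega>0 (int k - int L)) \<delta>"
            and m: "m \<in> {- int L..int L}"
          have "nat (m + int L) \<le> 2 * L" using m by auto
          moreover have "n + 1 + j + nat (m + int L) = nat (m + int j + int N)"
            "int (nat (m + int L)) - int L = m" using m by (auto simp: N_def)
          ultimately show "\<zeta> (nat (m + int j + int N)) w \<in> ball (\<omega>0 m) \<delta>" using h by metis
        next
          fix k assume h: "\<forall>m\<in>{- int L..int L}. \<zeta> (nat (m + int j + int N)) w \<in> ball (\<omega>0 m) \<delta>"
            and k: "k \<le> 2 * L"
          have "int k - int L \<in> {- int L..int L}" using k by auto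
          moreover have "nat (int k - int L + int j + int N) = n + 1 + j + k" by (simp add: N_def)
          ultimately show "\<zeta> (n + 1 + j + k) w \<in> ball (\<omega>0 (int k - int L)) \<delta>" using h by metis
        qed
        finally show ?thesis by blast
      qed
      then have "{j. j < n \<and> H (\<lambda>i\<in>I. \<zeta> (nat (i + int N)) w) j} = {j. j < n \<and> w \<in> ?E (n + 1 + j)}"
        if "w \<in> space M" for w
        using that H_restrict by blast
      moreover have "(\<lambda>i\<in>I. \<zeta> (nat (i + int N)) w) \<in> space S" for w
        by (simp add: S_def space_PiM)
      ultimately show ?thesis unfolding G_def by auto
    qed
    finally show ?thesis by (simp only: M.emeasure_eq_measure)
  qed
  show "\<exists>c>0. \<forall>\<beta>>0. \<exists>d>0. \<forall>n\<ge>1. outer_measure_of P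
      {\<omega>. (\<Sum>j<n. indicator (orbit_set B n0 s) ((lshift ^^ j) \<omega>)) \<le> c * real n}
    \<le> ennreal (d / real n powr \<beta>)"
  proof (rule exI[of _ \<kappa>], intro conjI allI impI \<kappa>)
    fix \<beta> :: real assume "\<beta> > 0"
    with decay obtain d where "d > 0" and d: "\<forall>n\<ge>1.
      measure M {w \<in> space M. real (card {j. j < n \<and> w \<in> ?E (n + 1 + j)}) \<le> \<kappa> * real n} \<le> d / real n powr \<beta>"
      by blast
    show "\<exists>d>0. \<forall>n\<ge>1. outer_measure_of P
        {\<omega>. (\<Sum>j<n. indicator (orbit_set B n0 s) ((lshift ^^ j) \<omega>)) \<le> \<kappa> * real n}
      \<le> ennreal (d / real n powr \<beta>)"
    proof (rule exI[of _ d], intro conjI allI impI \<open>d > 0\<close>)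
      fix n :: nat assume "n \<ge> 1"
      then show "outer_measure_of P
          {\<omega>. (\<Sum>j<n. indicator (orbit_set B n0 s) ((lshift ^^ j) \<omega>)) \<le> \<kappa> * real n}
        \<le> ennreal (d / real n powr \<beta>)"
        using order_trans[OF outer_le ennreal_leI] d by simp
    qed
  qed
qed

end
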